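(* Let $p(\overline{x_n})$ be a polynomial with integer coefficients in the unknowns $x_1,\ldots,x_n$, let $F$ be a function variable of arity $n$, let $s=\mathrm{cvt}[F,p(\overline{x_n})]^+$ and $t=\mathrm{cvt}[F,p(\overline{x_n})]^-$, and let $(\{s\stackrel{?}{=}_F t\},\mathcal{A},F)$ be the ASOGU problem induced by $p(\overline{x_n})$. Then there exist non-negative integers $h_1,\ldots,h_n\geq 0$ such that $$\sigma=\bigl\{F\mapsto\lambda x_1\ldots x_n.\,g(\overbrace{x_1,\ldots,x_1}^{h_1},\ldots,\overbrace{x_n,\ldots,x_n}^{h_n})\bigr\}$$ is a unifier of $\{s\stackrel{?}{=}_F t\}$ if and only if $\{x_i\mapsto h_i\mid 1\leq i\leq n\}$ is a solution to $p(\overline{x_n})=0$.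
   Context: The signature $\Sigma$ is finite and contains a binary symbol $g$ and a constant $a$; $\mathcal{A}=\{g(x,g(y,z))=g(g(x,y),z)\}$, and $\approx_{\mathcal{A}}$ is the equational theory induced by $\mathcal{A}$. Terms are written in flattened form: $g(u_1,\ldots,u_m)$ stands for a nested application of $g$ to $u_1,\ldots,u_m$ in this order, intermediate occurrences of $g$ being dropped. $a^k$ stands for a sequence of $k$ copies of $a$. $\overline{x_n}$ abbreviates $x_1,\ldots,x_n$. A function variable has arity $>0$; $F$ of arity $n$ is applied to $n$ argument terms. For $\sigma=\{F\mapsto\lambda x_1\ldots x_n.r\}$, $u\sigma$ is taken in $\beta$-normal form: $F(u_1,\ldots,u_n)\sigma$ is the result of simultaneously replacing each $x_i$ in $r$ by $u_i\sigma$, and $f(u_1,\ldots,u_l)\sigma=f(u_1\sigma,\ldots,u_l\sigma)$ for $f\in\Sigma$. Such a $\sigma$ is a unifier of $\{s\stackrel{?}{=}_F t\}$ (as part of the problem with theory $\mathcal{A}$) if $s\sigma\approx_{\mathcal{A}}t\sigma$. Monomial groupings. Polynomials are in reduced form (multiplication fully distributed over addition, like terms combined), have integer coefficients, and their unknowns range over the natural numbers (with $0$). For each polynomial $p(\overline{x_n})$ a total linear order $<_p$ on $x_1,\ldots,x_n$ is fixed. $p_0\in\mathbb{Z}$ denotes the constant term of $p$. For $1\leq j\leq n$, $p_{x_j}$ is the sum of those monomials of $p$ that are divisible by $x_j$ and not divisible by any $x_i$ with $x_i<_p x_j$ (and $p_{x_j}=0$ if there are none). Writing $p_{x_j}=x_j\cdot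 p'$, the reduction is $p_{x_j}\!\downarrow\;=p'$. $n$-converter. The terms $\mathrm{cvt}[F,p]^+$ and $\mathrm{cvt}[F,p]^-$ are defined recursively. If $p=c$ is constant: $\mathrm{cvt}[F,p]^+=g(a^{c+1})$ if $c\geq 1$ and $\mathrm{cvt}[F,p]^+=a$ if $c\leq 0$; $\mathrm{cvt}[F,p]^-=g(a^{|c|+1})$ if $c<0$ and $\mathrm{cvt}[F,p]^-=a$ if $c\geq 0$. If $p\neq p_0$, put $c=p_0$ and, for $\star\in\{+,-\}$ and $1\leq i\leq n$, $t_i^\star=\mathrm{cvt}[F,p_{x_i}\!\downarrow]^\star$; then $\mathrm{cvt}[F,p]^+=g(a^{c},F(t_1^+,\ldots,t_n^+))$ if $c\geq 1$ and $\mathrm{cvt}[F,p]^+=F(t_1^+,\ldots,t_n^+)$ if $c\leq 0$; $\mathrm{cvt}[F,p]^-=g(a^{|c|},F(t_1^-,\ldots,t_n^-))$ if $c<0$ and $\mathrm{cvt}[F,p]^-=F(t_1^-,\ldots,t_n^-)$ if $c\geq 0$. The ASOGU (associative second-order ground unification) problem induced by $p$ is the triple consisting of the single unification equation between $\mathrm{cvt}[F,p]^-$ and $\mathrm{cvt}[F,p]^+$, the theory $\mathcal{A}$, and $F$. *)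

theory Defs
  imports Main "HOL-Library.Poly_Mapping"
begin

section \<open>Polynomials\<close>

text \<open>Unknowns are indexed from 0: the unknown \<open>x\<^sub>i\<^sub>+\<^sub>1\<close> is the index \<open>i\<close>, and a polynomial in
  \<open>n\<close> unknowns is one whose indices all lie in \<open>{..<n}\<close>. A polynomial in reduced form is its finite
  map from monomials (exponent vectors) to nonzero integer coefficients.\<close>

type_synonym poly_int = "(nat \<Rightarrow>\<^sub>0 nat) \<Rightarrow>\<^sub>0 int"

definition pvars :: "poly_int \<Rightarrow> nat set" where
  "pvars p = (\<Union>m\<in>Poly_Mapping.keys p. Poly_Mapping.keys m)"

definition peval :: "poly_int \<Rightarrow> (nat \<Rightarrow> nat) \<Rightarrow> int" where
  "peval p h = (\<Sum>m\<in>Poly_Mapping.keys p.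
     Poly_Mapping.lookup p m * (\<Prod>i\<in>Poly_Mapping.keys m. int (h i) ^ Poly_Mapping.lookup m i))"

definition const_term :: "poly_int \<Rightarrow> int" where
  "const_term p = Poly_Mapping.lookup p 0"

definition is_const :: "poly_int \<Rightarrow> bool" where
  "is_const p \<longleftrightarrow> p = Poly_Mapping.single 0 (const_term p)"

definition punknown :: "nat \<Rightarrow> poly_int" where
  "punknown i = Poly_Mapping.single (Poly_Mapping.single i 1) 1"

text \<open>The monomial grouping \<open>p\<^bsub>x\<^sub>j\<^esub>\<close> with respect to an order \<open>r\<close> on the unknowns.\<close>

definition grouping :: "(nat \<times> nat) set \<Rightarrow> poly_int \<Rightarrow> nat \<Rightarrow> poly_int" where
  "grouping r p j =
     (\<Sum>m | m \<in> Poly_Mapping.keys p \<and> Poly_Mapping.lookup m j > 0 \<and>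
            (\<forall>i. (i, j) \<in> r \<longrightarrow> Poly_Mapping.lookup m i = 0).
        Poly_Mapping.single m (Poly_Mapping.lookup p m))"

text \<open>Division of every monomial by \<open>x\<^sub>j\<close>. This is the intended quotient only if \<open>x\<^sub>j\<close> divides all
  monomials, as in \<open>grouping_eq\<close> below.\<close>

definition reduct :: "nat \<Rightarrow> poly_int \<Rightarrow> poly_int" where
  "reduct j q = (\<Sum>m\<in>Poly_Mapping.keys q.
     Poly_Mapping.single (m - Poly_Mapping.single j 1) (Poly_Mapping.lookup q m))"

lemma keys_grouping:
  "Poly_Mapping.keys (grouping r p j) \<subseteq>
     {m \<in> Poly_Mapping.keys p. Poly_Mapping.lookup m j > 0 \<and>
        (\<forall>i. (i, j) \<in> r \<longrightarrow> Poly_Mapping.lookup m i = 0)}"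
  unfolding grouping_def
  by (rule subset_trans[OF keys_sum]) (auto split: if_splits)

lemma poly_mapping_eq_sum_single:
  fixes q :: "'a \<Rightarrow>\<^sub>0 ('b :: comm_monoid_add)"
  shows "(\<Sum>m\<in>Poly_Mapping.keys q. Poly_Mapping.single m (Poly_Mapping.lookup q m)) = q"
  by (rule poly_mapping_eqI)
     (auto simp: lookup_sum lookup_single when_def in_keys_iff sum.delta)

lemma grouping_eq: "grouping r p j = punknown j * reduct j (grouping r p j)"
proof -
  let ?q = "grouping r p j"
  have "punknown j * reduct j ?q =
    (\<Sum>m\<in>Poly_Mapping.keys ?q. Poly_Mapping.single
        (Poly_Mapping.single j 1 + (m - Poly_Mapping.single j 1)) (Poly_Mapping.lookup ?q m))"
    by (simp add: reduct_def punknown_def sum_distrib_left mult_single)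
  also have "\<dots> = (\<Sum>m\<in>Poly_Mapping.keys ?q. Poly_Mapping.single m (Poly_Mapping.lookup ?q m))"
  proof (rule sum.cong[OF refl])
    fix m assume "m \<in> Poly_Mapping.keys ?q"
    then have "Poly_Mapping.lookup m j > 0" using keys_grouping by blast
    then have "Poly_Mapping.single j 1 + (m - Poly_Mapping.single j 1) = m"
      by (intro poly_mapping_eqI) (auto simp: lookup_add lookup_minus lookup_single when_def)
    then show "Poly_Mapping.single
        (Poly_Mapping.single j 1 + (m - Poly_Mapping.single j 1)) (Poly_Mapping.lookup ?q m)
      = Poly_Mapping.single m (Poly_Mapping.lookup ?q m)" by simp
  qed
  also have "\<dots> = ?q" by (rule poly_mapping_eq_sum_single)
  finally show ?thesis by simp
qed

definition mdeg :: "(nat \<Rightarrow>\<^sub>0 nat) \<Rightarrow> nat" where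
  "mdeg m = (\<Sum>i\<in>Poly_Mapping.keys m. Poly_Mapping.lookup m i)"

definition pdeg :: "poly_int \<Rightarrow> nat" where
  "pdeg p = Max (insert 0 (mdeg ` Poly_Mapping.keys p))"

lemma mdeg_diff_single:
  assumes "Poly_Mapping.lookup m j > 0"
  shows "mdeg (m - Poly_Mapping.single j 1) < mdeg m"
proof -
  let ?m' = "m - Poly_Mapping.single j (1::nat)"
  have le: "Poly_Mapping.lookup ?m' i \<le> Poly_Mapping.lookup m i" for i
    by (simp add: lookup_minus)
  have sub: "Poly_Mapping.keys ?m' \<subseteq> Poly_Mapping.keys m"
  proof
    fix i assume "i \<in> Poly_Mapping.keys ?m'"
    with le[of i] show "i \<in> Poly_Mapping.keys m" unfolding in_keys_iff by linarith
  qed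
  have "mdeg ?m' = (\<Sum>i\<in>Poly_Mapping.keys m. Poly_Mapping.lookup ?m' i)"
    unfolding mdeg_def by (rule sum.mono_neutral_left) (use sub in \<open>auto simp: in_keys_iff\<close>)
  also have "\<dots> < mdeg m"
    unfolding mdeg_def
  proof (rule sum_strict_mono_ex1)
    show "\<exists>a\<in>Poly_Mapping.keys m. Poly_Mapping.lookup ?m' a < Poly_Mapping.lookup m a"
      using assms by (intro bexI[of _ j]) (auto simp: lookup_minus in_keys_iff)
  qed (use le in auto)
  finally show ?thesis .
qed

lemma pdeg_pos:
  assumes "\<not> is_const p"
  shows "pdeg p > 0"
proof -
  have "\<exists>m\<in>Poly_Mapping.keys p. m \<noteq> 0"
  proof (rule ccontr)
    assume "\<not> ?thesis"
    then have "p = Poly_Mapping.single 0 (const_term p)"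
      by (intro poly_mapping_eqI)
         (auto simp: const_term_def lookup_single when_def in_keys_iff)
    with assms show False by (simp add: is_const_def)
  qed
  then obtain m where m: "m \<in> Poly_Mapping.keys p" "m \<noteq> 0" by blast
  from m(2) have "mdeg m > 0"
    by (auto simp: mdeg_def in_keys_iff intro!: poly_mapping_eqI)
  also have "mdeg m \<le> pdeg p" using m(1) by (auto simp: pdeg_def)
  finally show ?thesis .
qed

lemma pdeg_reduct_grouping:
  assumes "\<not> is_const p"
  shows "pdeg (reduct j (grouping r p j)) < pdeg p"
proof -
  have "mdeg m' < pdeg p" if m': "m' \<in> Poly_Mapping.keys (reduct j (grouping r p j))" for m'
  proof -
    have "m' \<in> (\<Union>m\<in>Poly_Mapping.keys (grouping r p j). {m - Poly_Mapping.single j 1})"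
      using m' keys_sum unfolding reduct_def by (fastforce split: if_splits)
    then obtain m where m: "m \<in> Poly_Mapping.keys (grouping r p j)"
      "m' = m - Poly_Mapping.single j 1" by blast
    from m(1) keys_grouping have "m \<in> Poly_Mapping.keys p" "Poly_Mapping.lookup m j > 0"
      by blast+
    with m(2) mdeg_diff_single[of m j] have "mdeg m' < mdeg m" "mdeg m \<le> pdeg p"
      by (auto simp: pdeg_def)
    then show ?thesis by simp
  qed
  then show ?thesis using pdeg_pos[OF assms] unfolding pdeg_def[of "reduct _ _"] by auto
qed


section \<open>Terms, substitutions, equational theories\<close>

text \<open>\<open>Var i\<close> serves both for the variables of equational axioms and for the bound
  variables of a substitution \<open>F \<mapsto> \<lambda>x\<^sub>1\<dots>x\<^sub>n. r\<close>, where \<open>Var i\<close> is \<open>x\<^sub>i\<^sub>+\<^sub>1\<close>.\<close>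

datatype ('f, 'v) trm =
    Var nat
  | Fn 'f "('f, 'v) trm list"
  | FVar 'v "('f, 'v) trm list"

fun wf_trm :: "('f \<Rightarrow> nat) \<Rightarrow> ('v \<Rightarrow> nat) \<Rightarrow> ('f, 'v) trm \<Rightarrow> bool" where
  "wf_trm ar av (Var i) = True"
| "wf_trm ar av (Fn f ts) = (length ts = ar f \<and> (\<forall>t\<in>set ts. wf_trm ar av t))"
| "wf_trm ar av (FVar G ts) = (length ts = av G \<and> (\<forall>t\<in>set ts. wf_trm ar av t))"

fun ground :: "('f, 'v) trm \<Rightarrow> bool" where
  "ground (Var i) = False"
| "ground (Fn f ts) = (\<forall>t\<in>set ts. ground t)"
| "ground (FVar G ts) = False"

fun subst :: "(nat \<Rightarrow> ('f, 'v) trm) \<Rightarrow> ('f, 'v) trm \<Rightarrow> ('f, 'v) trm" where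
  "subst \<theta> (Var i) = \<theta> i"
| "subst \<theta> (Fn f ts) = Fn f (map (subst \<theta>) ts)"
| "subst \<theta> (FVar G ts) = FVar G (map (subst \<theta>) ts)"

text \<open>\<open>so_subst F r u\<close> is the \<open>\<beta>\<close>-normal form of \<open>u\<close> under \<open>F \<mapsto> \<lambda>x\<^sub>1\<dots>x\<^sub>n. r\<close>.\<close>

fun so_subst :: "'v \<Rightarrow> ('f, 'v) trm \<Rightarrow> ('f, 'v) trm \<Rightarrow> ('f, 'v) trm" where
  "so_subst F r (Var i) = Var i"
| "so_subst F r (Fn f us) = Fn f (map (so_subst F r) us)"
| "so_subst F r (FVar G us) =
     (let vs = map (so_subst F r) us in
      if G = F then subst (\<lambda>i. if i < length vs then vs ! i else Var i) r else FVar G vs)"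

inductive eq_theory :: "(('f, 'v) trm \<times> ('f, 'v) trm) set \<Rightarrow> ('f, 'v) trm \<Rightarrow> ('f, 'v) trm \<Rightarrow> bool"
  for E where
  refl: "eq_theory E t t"
| sym: "eq_theory E s t \<Longrightarrow> eq_theory E t s"
| trans: "eq_theory E s t \<Longrightarrow> eq_theory E t u \<Longrightarrow> eq_theory E s u"
| inst: "(l, r) \<in> E \<Longrightarrow> eq_theory E (subst \<theta> l) (subst \<theta> r)"
| cong_Fn: "eq_theory E s t \<Longrightarrow> eq_theory E (Fn f (us @ s # vs)) (Fn f (us @ t # vs))"
| cong_FVar: "eq_theory E s t \<Longrightarrow> eq_theory E (FVar G (us @ s # vs)) (FVar G (us @ t # vs))"

definition assoc_axioms :: "'f \<Rightarrow> (('f, 'v) trm \<times> ('f, 'v) trm) set" where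
  "assoc_axioms g =
     {(Fn g [Var 0, Fn g [Var 1, Var 2]], Fn g [Fn g [Var 0, Var 1], Var 2])}"

text \<open>The flattened form \<open>g(u\<^sub>1,\<dots>,u\<^sub>m)\<close>, \<open>m \<ge> 1\<close>, represented by its right-nested application;
  \<open>g(u\<^sub>1)\<close> is \<open>u\<^sub>1\<close>.\<close>

fun flat :: "'f \<Rightarrow> ('f, 'v) trm list \<Rightarrow> ('f, 'v) trm" where
  "flat g [u] = u"
| "flat g (u # v # us) = Fn g [u, flat g (v # us)]"


section \<open>The converter and the induced unification problem\<close>

datatype sign = Plus | Minus

text \<open>The number of copies of \<open>a\<close> contributed by the constant term \<open>c\<close>:
  \<open>c\<close> if \<open>c \<ge> 1\<close>, else \<open>0\<close>, for \<open>Plus\<close>; \<open>|c|\<close> if \<open>c < 0\<close>, else \<open>0\<close>, for \<open>Minus\<close>.\<close>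

fun sign_part :: "sign \<Rightarrow> int \<Rightarrow> nat" where
  "sign_part Plus c = nat c"
| "sign_part Minus c = nat (- c)"

text \<open>\<open>ord p\<close> is the order on the unknowns fixed for the polynomial \<open>p\<close>. The cases in which
  \<open>sign_part\<close> is \<open>0\<close> need no distinction, since \<open>flat g [u] = u\<close>.\<close>

function cvt :: "(poly_int \<Rightarrow> (nat \<times> nat) set) \<Rightarrow> nat \<Rightarrow> 'f \<Rightarrow> 'f \<Rightarrow> 'v \<Rightarrow> sign \<Rightarrow> poly_int
    \<Rightarrow> ('f, 'v) trm" where
  "cvt ord n g a F s p =
     (let k = sign_part s (const_term p) in
      if is_const p then flat g (replicate (k + 1) (Fn a []))
      else flat g (replicate k (Fn a []) @
             [FVar F (map (\<lambda>i. cvt ord n g a F s (reduct i (grouping (ord p) p i))) [0..<n])]))"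
  by pat_completeness auto
termination
  by (relation "Wellfounded.measure (\<lambda>(ord, n, g, a, F, s, p). pdeg p)")
     (auto simp: pdeg_reduct_grouping)

declare cvt.simps [simp del]

type_synonym ('f, 'v) asogu =
  "(('f, 'v) trm \<times> ('f, 'v) trm) set \<times> (('f, 'v) trm \<times> ('f, 'v) trm) set \<times> 'v"

definition induced_asogu :: "(poly_int \<Rightarrow> (nat \<times> nat) set) \<Rightarrow> nat \<Rightarrow> 'f \<Rightarrow> 'f \<Rightarrow> 'v \<Rightarrow> poly_int
    \<Rightarrow> ('f, 'v) asogu" where
  "induced_asogu ord n g a F p =
     ({(cvt ord n g a F Plus p, cvt ord n g a F Minus p)}, assoc_axioms g, F)"

text \<open>\<open>is_unifier P r\<close>: \<open>F \<mapsto> \<lambda>x\<^sub>1\<dots>x\<^sub>n. r\<close> is a unifier of the problem \<open>P\<close>.\<close>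

fun is_unifier :: "('f, 'v) asogu \<Rightarrow> ('f, 'v) trm \<Rightarrow> bool" where
  "is_unifier (U, E, F) r \<longleftrightarrow> (\<forall>(s, t)\<in>U. eq_theory E (so_subst F r s) (so_subst F r t))"

text \<open>The body \<open>g(x\<^sub>1,\<dots>,x\<^sub>1,\<dots>,x\<^sub>n,\<dots>,x\<^sub>n)\<close> with \<open>h\<^sub>i\<close> copies of \<open>x\<^sub>i\<close>. If all \<open>h\<^sub>i\<close> are \<open>0\<close> the
  flattened form has no arguments and denotes no nested application of \<open>g\<close>; the parameter \<open>e\<close> is
  what it stands for in this case (and plays no role otherwise).\<close>

definition unif_body :: "'f \<Rightarrow> ('f, 'v) trm \<Rightarrow> nat \<Rightarrow> (nat \<Rightarrow> nat) \<Rightarrow> ('f, 'v) trm" where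
  "unif_body g e n h =
     (if \<forall>i<n. h i = 0 then e
      else flat g (concat (map (\<lambda>i. replicate (h i) (Var i)) [0..<n])))"

end

theory Submission
  imports Defs
begin

text \<open>
  Modulo associativity a term is determined by its list of non-\<open>g\<close> leaves, so the number of leaves
  is an invariant of the theory. Let \<open>N\<^sup>+(p)\<close>, \<open>N\<^sup>-(p)\<close> be the numbers of leaves of the two converters
  of \<open>p\<close> after substitution. Since \<open>p = p\<^sub>0 + \<Sum>\<^sub>i x\<^sub>i \<cdot> p\<^bsub>x\<^sub>i\<^esub>\<down>\<close>, the recursion gives
  \<open>N\<^sup>+(p) - N\<^sup>-(p) = p(h)\<close>. Unless all \<open>h\<^sub>i\<close> vanish, all leaves are equal to \<open>a\<close>, so equal numbers
  of leaves suffice for unification. If all \<open>h\<^sub>i\<close> vanish, the difference is just the constant term,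
  and both sides coincide syntactically when it is \<open>0\<close>.
\<close>

section \<open>Evaluation of monomial groupings\<close>

definition monom_eval :: "(nat \<Rightarrow> nat) \<Rightarrow> (nat \<Rightarrow>\<^sub>0 nat) \<Rightarrow> int" where
  "monom_eval h m = (\<Prod>i\<in>Poly_Mapping.keys m. int (h i) ^ Poly_Mapping.lookup m i)"

text \<open>An unknown outside the keys has exponent 0 and contributes the factor 1, also at
  \<open>h i = 0\<close>, because \<open>0 ^ 0 = 1\<close>.\<close>

lemma monom_eval_superset:
  assumes "finite A" "Poly_Mapping.keys m \<subseteq> A"
  shows "monom_eval h m = (\<Prod>i\<in>A. int (h i) ^ Poly_Mapping.lookup m i)"
  unfolding monom_eval_def
  by (rule prod.mono_neutral_left) (use assms in \<open>auto simp: in_keys_iff\<close>)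

lemma monom_eval_zero [simp]: "monom_eval h 0 = 1"
  by (simp add: monom_eval_def)

text \<open>Only the exponent at \<open>j\<close> changes. As \<open>j\<close> may drop out of the
  keys after the division, both products run over the keys of \<open>m\<close>.\<close>

lemma monom_eval_diff_single:
  assumes "Poly_Mapping.lookup m j > 0"
  shows "monom_eval h m = int (h j) * monom_eval h (m - Poly_Mapping.single j 1)"
proof -
  let ?A = "Poly_Mapping.keys m" and ?m = "m - Poly_Mapping.single j (1::nat)"
  have j: "j \<in> ?A" using assms by (simp add: in_keys_iff)
  have sub: "Poly_Mapping.keys ?m \<subseteq> ?A"
    by (auto simp: in_keys_iff lookup_minus)
  have rest: "(\<Prod>i\<in>?A - {j}. int (h i) ^ Poly_Mapping.lookup ?m i) =
      (\<Prod>i\<in>?A - {j}. int (h i) ^ Poly_Mapping.lookup m i)"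
    by (rule prod.cong) (auto simp: lookup_minus lookup_single when_def)
  have "monom_eval h ?m = int (h j) ^ (Poly_Mapping.lookup m j - 1) *
      (\<Prod>i\<in>?A - {j}. int (h i) ^ Poly_Mapping.lookup m i)"
    unfolding monom_eval_superset[OF finite_keys sub] prod.remove[OF finite_keys j] rest
    by (simp add: lookup_minus)
  moreover have "monom_eval h m = int (h j) ^ Poly_Mapping.lookup m j *
      (\<Prod>i\<in>?A - {j}. int (h i) ^ Poly_Mapping.lookup m i)"
    by (simp add: monom_eval_def prod.remove[OF _ j])
  moreover have "int (h j) ^ Poly_Mapping.lookup m j =
      int (h j) * int (h j) ^ (Poly_Mapping.lookup m j - 1)"
    using assms by (metis power_eq_if not_gr_zero)
  ultimately show ?thesis by (simp add: mult.assoc)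
qed

text \<open>Coefficients may cancel in \<open>p + q\<close>, so its keys can be fewer than those of
  the summands; a common index set makes the sums comparable.\<close>

lemma peval_superset:
  assumes "finite A" "Poly_Mapping.keys p \<subseteq> A"
  shows "peval p h = (\<Sum>m\<in>A. Poly_Mapping.lookup p m * monom_eval h m)"
  unfolding peval_def monom_eval_def
  by (rule sum.mono_neutral_left) (use assms in \<open>auto simp: in_keys_iff\<close>)

lemma peval_eq_sum_monom_eval:
  "peval p h = (\<Sum>m\<in>Poly_Mapping.keys p. Poly_Mapping.lookup p m * monom_eval h m)"
  by (simp add: peval_superset)

lemma peval_zero [simp]: "peval 0 h = 0"
  by (simp add: peval_def)

lemma peval_single [simp]: "peval (Poly_Mapping.single m c) h = c * monom_eval h m"
  by (simp add: peval_superset[of "{m}"])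

lemma peval_add: "peval (p + q) h = peval p h + peval q h"
proof -
  let ?A = "Poly_Mapping.keys p \<union> Poly_Mapping.keys q"
  have "peval (p + q) h = (\<Sum>m\<in>?A. Poly_Mapping.lookup (p + q) m * monom_eval h m)"
    by (rule peval_superset) (simp_all add: Poly_Mapping.keys_add)
  also have "\<dots> = peval p h + peval q h"
    by (simp add: peval_superset[of ?A] lookup_add algebra_simps sum.distrib)
  finally show ?thesis .
qed

lemma peval_sum: "peval (\<Sum>x\<in>A. f x) h = (\<Sum>x\<in>A. peval (f x) h)"
  by (induction A rule: infinite_finite_induct) (auto simp: peval_add)

text \<open>Subtraction of exponents is truncated, so the premise is what makes the division by
  unknown \<open>j\<close> exact. Evaluating the defining sum termwise avoids computing the support
  of the quotient.\<close>

lemma peval_reduct: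
  assumes "\<And>m. m \<in> Poly_Mapping.keys q \<Longrightarrow> Poly_Mapping.lookup m j > 0"
  shows "int (h j) * peval (reduct j q) h = peval q h"
  unfolding reduct_def peval_sum peval_single peval_eq_sum_monom_eval[of q] sum_distrib_left
  using assms by (intro sum.cong) (simp_all add: monom_eval_diff_single[of _ j])

text \<open>Keeps the bound on the unknowns alive along the recursion of \<open>cvt\<close>, so that
  the order fixed for each polynomial reached is again linear.\<close>

lemma pvars_reduct_grouping: "pvars (reduct j (grouping r p j)) \<subseteq> pvars p"
proof
  fix i assume "i \<in> pvars (reduct j (grouping r p j))"
  then obtain m' where m': "m' \<in> Poly_Mapping.keys (reduct j (grouping r p j))"
    and i: "i \<in> Poly_Mapping.keys m'" by (auto simp: pvars_def)
  have "m' \<in> (\<Union>m\<in>Poly_Mapping.keys (grouping r p j). {m - Poly_Mapping.single j 1})"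
    using m' keys_sum unfolding reduct_def by (fastforce split: if_splits)
  then obtain m where m: "m \<in> Poly_Mapping.keys (grouping r p j)"
    "m' = m - Poly_Mapping.single j 1" by blast
  then have "m \<in> Poly_Mapping.keys p" using keys_grouping by blast
  moreover have "i \<in> Poly_Mapping.keys m"
    using i m(2) by (auto simp: in_keys_iff lookup_minus)
  ultimately show "i \<in> pvars p" by (auto simp: pvars_def)
qed

text \<open>Finiteness and acyclicity give well-foundedness, hence existence; totality gives
  uniqueness. With \<open>B\<close> the unknowns of a monomial, this selects the one grouping
  containing it.\<close>

lemma ex1_minimal_strict_linear_order:
  assumes "finite A" "r \<subseteq> A \<times> A" "strict_linear_order_on A r" "B \<subseteq> A" "B \<noteq> {}"
  shows "\<exists>!j. j \<in> B \<and> (\<forall>i. (i, j) \<in> r \<longrightarrow> i \<notin> B)"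
proof -
  have tr: "trans r" "irrefl r" "total_on A r"
    using assms(3) by (auto simp: strict_linear_order_on_def)
  have "acyclic r" using tr by (simp add: acyclic_irrefl)
  moreover have "finite r" using assms(1,2) by (meson finite_SigmaI finite_subset)
  ultimately have "wf r" by (simp add: finite_acyclic_wf)
  then obtain j where "j \<in> B" "\<forall>i. (i, j) \<in> r \<longrightarrow> i \<notin> B"
    using assms(5) by (metis ex_in_conv wf_eq_minimal)
  moreover have "i = j" if "i \<in> B" "\<forall>k. (k, i) \<in> r \<longrightarrow> k \<notin> B" "j \<in> B"
    "\<forall>k. (k, j) \<in> r \<longrightarrow> k \<notin> B" for i j
    using that assms(4) tr(3) unfolding total_on_def by blast
  ultimately show ?thesis by blast
qed

text \<open>Each nonconstant monomial belongs to the grouping of its least unknown and to no other,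
  so the groupings partition the nonconstant part of \<open>p\<close>.\<close>

lemma peval_eq_const_term_plus_groupings:
  assumes "r \<subseteq> {..<n} \<times> {..<n}" "strict_linear_order_on {..<n} r" "pvars p \<subseteq> {..<n}"
  shows "peval p h =
    const_term p + (\<Sum>j<n. int (h j) * peval (reduct j (grouping r p j)) h)"
proof -
  let ?c = "\<lambda>m. Poly_Mapping.lookup p m * monom_eval h m"
  let ?K = "\<lambda>j. {m \<in> Poly_Mapping.keys p. Poly_Mapping.lookup m j > 0 \<and>
      (\<forall>i. (i, j) \<in> r \<longrightarrow> Poly_Mapping.lookup m i = 0)}"
  have unique: "\<exists>!j. m \<in> ?K j" "\<And>j. m \<in> ?K j \<Longrightarrow> j < n"
    if m: "m \<in> Poly_Mapping.keys p" "m \<noteq> 0" for m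
  proof -
    have sub: "Poly_Mapping.keys m \<subseteq> {..<n}" using m(1) assms(3) by (auto simp: pvars_def)
    then have "\<exists>!j. j \<in> Poly_Mapping.keys m \<and> (\<forall>i. (i, j) \<in> r \<longrightarrow> i \<notin> Poly_Mapping.keys m)"
      using ex1_minimal_strict_linear_order[OF _ assms(1,2)] m(2) by simp
    then show "\<exists>!j. m \<in> ?K j" using m(1) by (simp add: in_keys_iff)
    show "j < n" if "m \<in> ?K j" for j
    proof -
      have "j \<in> Poly_Mapping.keys m" using that by (simp add: in_keys_iff)
      with sub show ?thesis by blast
    qed
  qed
  have "int (h j) * peval (reduct j (grouping r p j)) h = sum ?c (?K j)" for j
  proof -
    have "int (h j) * peval (reduct j (grouping r p j)) h = peval (grouping r p j) h"
      using keys_grouping by (intro peval_reduct) blast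
    also have "\<dots> = sum ?c (?K j)"
      by (simp add: grouping_def peval_sum)
    finally show ?thesis .
  qed
  then have "(\<Sum>j<n. int (h j) * peval (reduct j (grouping r p j)) h) = (\<Sum>j<n. sum ?c (?K j))"
    by simp
  also have "\<dots> = sum ?c (\<Union>j<n. ?K j)"
  proof (rule sum.UNION_disjoint[symmetric])
    show "\<forall>i\<in>{..<n}. \<forall>j\<in>{..<n}. i \<noteq> j \<longrightarrow> ?K i \<inter> ?K j = {}"
    proof (intro ballI impI equals0I)
      fix i j m assume "i \<noteq> j" and m: "m \<in> ?K i \<inter> ?K j"
      then have "m \<in> Poly_Mapping.keys p" "m \<noteq> 0" by auto
      then obtain k where k: "\<And>l. m \<in> ?K l \<Longrightarrow> l = k" using unique(1) by blast
      have "i = k" "j = k" using m by (auto intro: k)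
      with \<open>i \<noteq> j\<close> show False by simp
    qed
  qed auto
  also have "(\<Union>j<n. ?K j) = Poly_Mapping.keys p - {0}"
  proof (intro equalityI subsetI)
    fix m assume "m \<in> Poly_Mapping.keys p - {0}"
    then have m: "m \<in> Poly_Mapping.keys p" "m \<noteq> 0" by auto
    then obtain j where j: "m \<in> ?K j" using unique(1) by blast
    show "m \<in> (\<Union>j<n. ?K j)"
      using j unique(2)[OF m j] by blast
  qed auto
  \<comment> \<open>The monomial \<open>0\<close> need not be a key of \<open>p\<close>; if it is
    not, the inserted summand has coefficient 0.\<close>
  also have "const_term p + sum ?c (Poly_Mapping.keys p - {0}) =
      sum ?c (insert 0 (Poly_Mapping.keys p))"
    by (simp add: sum.insert_remove const_term_def)
  also have "\<dots> = peval p h"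
    by (rule peval_superset[symmetric]) auto
  finally show ?thesis by simp
qed

section \<open>Terms modulo associativity\<close>

text \<open>Only binary applications of \<open>g\<close> are opened; an application of
  \<open>g\<close> to any other number of arguments is itself a leaf, so no well-formedness has to
  be carried along.\<close>

fun leaves :: "'f \<Rightarrow> ('f, 'v) trm \<Rightarrow> ('f, 'v) trm list" where
  "leaves g (Fn f ts) =
     (if f = g \<and> length ts = 2 then concat (map (leaves g) ts) else [Fn f ts])"
| "leaves g t = [t]"

lemma leaves_neq_Nil [simp]: "leaves g t \<noteq> []"
proof (induction g t rule: leaves.induct)
  case (1 g f ts)
  then show ?case by (cases ts) auto
qed simp_all

text \<open>Nonemptiness is assumed here and below because \<open>flat\<close> has no equation for
  the empty list.\<close>

lemma leaves_flat: "us \<noteq> [] \<Longrightarrow> leaves g (flat g us) = concat (map (leaves g) us)"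
  by (induction g us rule: flat.induct) simp_all

lemma subst_flat: "us \<noteq> [] \<Longrightarrow> subst \<theta> (flat g us) = flat g (map (subst \<theta>) us)"
  by (induction g us rule: flat.induct) simp_all

lemma so_subst_flat: "us \<noteq> [] \<Longrightarrow> so_subst F r (flat g us) = flat g (map (so_subst F r) us)"
  by (induction g us rule: flat.induct) simp_all

lemma subst_ground: "ground t \<Longrightarrow> subst \<theta> t = t"
  by (induction t) (auto intro: map_idI)

text \<open>Only the length is invariant, not the list: a rewrite below another symbol changes the
  leaf headed by that symbol, but it remains one leaf.\<close>

lemma eq_theory_assoc_length_leaves:
  "eq_theory (assoc_axioms g) s t \<Longrightarrow> length (leaves g s) = length (leaves g t)"
  by (induction rule: eq_theory.induct) (auto simp: assoc_axioms_def)

lemma eq_theory_assoc: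
  "eq_theory (assoc_axioms g) (Fn g [u, Fn g [v, w]]) (Fn g [Fn g [u, v], w])"
proof -
  let ?\<theta> = "\<lambda>i::nat. if i = 0 then u else if i = 1 then v else w"
  show ?thesis
    using eq_theory.inst[of "Fn g [Var 0, Fn g [Var 1, Var 2]]"
      "Fn g [Fn g [Var 0, Var 1], Var 2]" "assoc_axioms g" ?\<theta>]
    by (simp add: assoc_axioms_def)
qed

lemma eq_theory_cong_Fn2:
  assumes "eq_theory E u u'" "eq_theory E v v'"
  shows "eq_theory E (Fn f [u, v]) (Fn f [u', v'])"
  using eq_theory.cong_Fn[OF assms(1), of f "[]" "[v]"]
    eq_theory.cong_Fn[OF assms(2), of f "[u']" "[]"]
  by (auto intro: eq_theory.trans)

text \<open>Induction on \<open>us\<close>: associativity moves the head \<open>u\<close> to the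
  front, and the induction hypothesis merges the two remaining flat terms under congruence.\<close>

lemma eq_theory_flat_append:
  assumes "us \<noteq> []" "vs \<noteq> []"
  shows "eq_theory (assoc_axioms g) (Fn g [flat g us, flat g vs]) (flat g (us @ vs))"
  using assms(1)
proof (induction us rule: list_nonempty_induct)
  case (single u)
  show ?case using assms(2) by (cases vs) (auto intro: eq_theory.refl)
next
  case (cons u us)
  let ?E = "assoc_axioms g"
  have flat_Cons: "flat g (u # ws) = Fn g [u, flat g ws]" if "ws \<noteq> []" for ws
    using that by (cases ws) auto
  have "eq_theory ?E (Fn g [Fn g [u, flat g us], flat g vs])
      (Fn g [u, Fn g [flat g us, flat g vs]])"
    by (rule eq_theory.sym[OF eq_theory_assoc])
  moreover have "eq_theory ?E (Fn g [u, Fn g [flat g us, flat g vs]])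
      (Fn g [u, flat g (us @ vs)])"
    by (rule eq_theory_cong_Fn2[OF eq_theory.refl cons.IH])
  ultimately show ?case
    using cons.hyps by (simp add: flat_Cons) (rule eq_theory.trans)
qed

text \<open>The right-nested term over the leaves is a normal form: both arguments of
  \<open>g\<close> are normalised first and then joined.\<close>

lemma eq_theory_flat_leaves: "eq_theory (assoc_axioms g) t (flat g (leaves g t))"
proof (induction g t rule: leaves.induct)
  case (1 g f ts)
  show ?case
  proof (cases "f = g \<and> length ts = 2")
    case True
    then obtain u v where ts: "ts = [u, v]"
      by (auto simp: numeral_2_eq_2 length_Suc_conv)
    have "eq_theory (assoc_axioms g) (Fn g [u, v]) (Fn g [flat g (leaves g u), flat g (leaves g v)])"
      using 1 True ts by (intro eq_theory_cong_Fn2) auto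
    from eq_theory.trans[OF this eq_theory_flat_append] show ?thesis
      using True ts by simp
  qed (auto intro: eq_theory.refl)
qed (auto intro: eq_theory.refl)

lemma eq_theory_assocI: "leaves g s = leaves g t \<Longrightarrow> eq_theory (assoc_axioms g) s t"
  by (metis eq_theory.sym eq_theory.trans eq_theory_flat_leaves)

section \<open>Leaves of the instantiated converters\<close>

text \<open>Each of the \<open>h i\<close> copies of \<open>Var i\<close> becomes a copy of
  \<open>\<theta> i\<close>. Taking lengths turns this into a sum weighted by \<open>h\<close>,
  matching the factors \<open>h j\<close> in the grouping formula.\<close>

lemma leaves_subst_unif_body:
  fixes e :: "('f, 'v) trm"
  assumes "\<not> (\<forall>i<n. h i = 0)"
  shows "leaves g (subst \<theta> (unif_body g e n h)) =
    concat (map (\<lambda>i. concat (replicate (h i) (leaves g (\<theta> i)))) [0..<n])"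
proof -
  let ?xs = "concat (map (\<lambda>i. replicate (h i) (Var i)) [0..<n]) :: ('f, 'v) trm list"
  have "?xs \<noteq> []" using assms by auto
  then have "leaves g (subst \<theta> (flat g ?xs)) = concat (map (\<lambda>u. leaves g (subst \<theta> u)) ?xs)"
    by (simp only: subst_flat leaves_flat map_is_Nil_conv map_map comp_def simp_thms not_False_eq_True)
  also have "\<dots> = concat (map (\<lambda>i. concat (replicate (h i) (leaves g (\<theta> i)))) [0..<n])"
    by (induction n) auto
  finally show ?thesis
    by (simp only: unif_body_def if_not_P[OF assms])
qed

text \<open>The one extra copy of \<open>a\<close> is present for both signs and cancels in the
  difference of leaf counts.\<close>

lemma leaves_so_subst_cvt_const:
  assumes "a \<noteq> g" "is_const p"
  shows "leaves g (so_subst F r (cvt ord n g a F s p)) =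
    replicate (sign_part s (const_term p) + 1) (Fn a [])"
  using assms
  by (subst cvt.simps) (simp add: Let_def so_subst_flat leaves_flat)

text \<open>The body \<open>r\<close> stays arbitrary, so that one recursion serves both forms of
  \<open>unif_body\<close>.\<close>

lemma leaves_so_subst_cvt:
  fixes r :: "('f, 'v) trm"
  assumes "a \<noteq> g" "\<not> is_const p"
  shows "leaves g (so_subst F r (cvt ord n g a F s p)) =
    replicate (sign_part s (const_term p)) (Fn a []) @
    leaves g (subst (\<lambda>i. if i < n
      then so_subst F r (cvt ord n g a F s (reduct i (grouping (ord p) p i))) else Var i) r)"
proof -
  have "(\<lambda>i. if i < n then map f [0..<n] ! i else Var i) = (\<lambda>i. if i < n then f i else Var i)"
    for f :: "nat \<Rightarrow> ('f, 'v) trm"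
    by auto
  then show ?thesis
    using assms by (subst cvt.simps) (simp add: Let_def so_subst_flat leaves_flat comp_def)
qed

text \<open>By induction on the degree: the body only copies its arguments, whose leaves are all
  \<open>a\<close>. If every \<open>h i\<close> is 0, the leaves of \<open>e\<close> may differ from
  \<open>a\<close>, hence the exclusion.\<close>

lemma set_leaves_so_subst_cvt:
  assumes "a \<noteq> g" "\<not> (\<forall>i<n. h i = 0)"
  shows "set (leaves g (so_subst F (unif_body g e n h) (cvt ord n g a F s p))) \<subseteq> {Fn a []}"
proof (induction p rule: measure_induct_rule[of pdeg])
  case (less p)
  show ?case
  proof (cases "is_const p")
    case True
    then show ?thesis using assms(1) by (auto simp: leaves_so_subst_cvt_const)
  next
    case False
    then show ?thesis
      using less.IH[OF pdeg_reduct_grouping[OF False]]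
      by (fastforce simp: leaves_so_subst_cvt[OF assms(1)] leaves_subst_unif_body[OF assms(2)])
  qed
qed

lemma sign_part_diff: "int (sign_part Plus c) - int (sign_part Minus c) = c"
  by simp

text \<open>Strong induction on the degree. The premise on \<open>ord\<close> ranges over all
  \<open>q\<close> because each recursive call uses the order fixed for its own polynomial.\<close>

lemma length_leaves_so_subst_cvt_diff:
  assumes "a \<noteq> g" "ground e"
    and ord: "\<And>q. pvars q \<subseteq> {..<n} \<Longrightarrow>
      ord q \<subseteq> {..<n} \<times> {..<n} \<and> strict_linear_order_on {..<n} (ord q)"
    and "pvars p \<subseteq> {..<n}"
  shows "int (length (leaves g (so_subst F (unif_body g e n h) (cvt ord n g a F Plus p)))) -
    int (length (leaves g (so_subst F (unif_body g e n h) (cvt ord n g a F Minus p)))) = peval p h"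
  using assms(4)
proof (induction p rule: measure_induct_rule[of pdeg])
  case (less p)
  let ?r = "unif_body g e n h"
  let ?L = "\<lambda>s q. length (leaves g (so_subst F ?r (cvt ord n g a F s q)))"
  let ?q = "\<lambda>i. reduct i (grouping (ord p) p i)"
  have peval: "peval p h = const_term p + (\<Sum>i<n. int (h i) * peval (?q i) h)"
    using ord[OF less.prems] less.prems by (intro peval_eq_const_term_plus_groupings) auto
  show ?case
  proof (cases "is_const p")
    case True
    then have "peval p h = const_term p"
      by (metis is_const_def monom_eval_zero mult.right_neutral peval_single)
    with True show ?thesis
      using sign_part_diff[of "const_term p"] assms(1)
      by (simp add: leaves_so_subst_cvt_const del: sign_part.simps)
  next
    case nonconst: False
    show ?thesis
    proof (cases "\<forall>i<n. h i = 0")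
      case True
      \<comment> \<open>All groupings vanish at \<open>h\<close>. The body is the ground term
        \<open>e\<close>, unchanged by substitution, so it adds equally many leaves on both
        sides.\<close>
      then have "peval p h = const_term p" using peval by simp
      with True show ?thesis
        using sign_part_diff[of "const_term p"] assms(1,2) nonconst
        by (simp add: leaves_so_subst_cvt unif_body_def subst_ground del: sign_part.simps)
    next
      case False
      have L: "int (?L s p) =
          int (sign_part s (const_term p)) + (\<Sum>i<n. int (h i) * int (?L s (?q i)))" for s
      proof -
        have "?L s p = sign_part s (const_term p) + (\<Sum>i<n. h i * ?L s (?q i))"
          by (simp add: leaves_so_subst_cvt[OF assms(1) nonconst] leaves_subst_unif_body[OF False]
            length_concat comp_def sum_list_replicate interv_sum_list_conv_sum_set_nat
            atLeast0LessThan)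
        then show ?thesis by simp
      qed
      have "int (?L Plus (?q i)) - int (?L Minus (?q i)) = peval (?q i) h" for i
        using less.IH[OF pdeg_reduct_grouping[OF nonconst]] pvars_reduct_grouping less.prems
        by blast
      then have "(\<Sum>i<n. int (h i) * peval (?q i) h) =
          (\<Sum>i<n. int (h i) * int (?L Plus (?q i))) - (\<Sum>i<n. int (h i) * int (?L Minus (?q i)))"
        by (simp flip: sum_subtractf right_diff_distrib)
      then show ?thesis
        using L[of Plus] L[of Minus] peval sign_part_diff[of "const_term p"] by linarith
    qed
  qed
qed

theorem lemma4p11:
  fixes ar :: "'f :: finite \<Rightarrow> nat" and av :: "'v \<Rightarrow> nat"
    and g a :: 'f and F :: 'v and n :: nat
    and ord :: "poly_int \<Rightarrow> (nat \<times> nat) set"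
    and p :: poly_int
    and e :: "('f, 'v) trm"
  assumes "ar g = 2" and "ar a = 0"
    and "av F = n" and "n > 0"
    and "\<And>q. pvars q \<subseteq> {..<n} \<Longrightarrow> ord q \<subseteq> {..<n} \<times> {..<n} \<and> strict_linear_order_on {..<n} (ord q)"
    and "pvars p \<subseteq> {..<n}"
    and "wf_trm ar av e" and "ground e"
  shows "(\<forall>h :: nat \<Rightarrow> nat.
            is_unifier (induced_asogu ord n g a F p) (unif_body g e n h) \<longleftrightarrow> peval p h = 0)
       \<and> ((\<exists>h :: nat \<Rightarrow> nat. is_unifier (induced_asogu ord n g a F p) (unif_body g e n h)) \<longleftrightarrow>
          (\<exists>h :: nat \<Rightarrow> nat. peval p h = 0))"
proof -
  let ?\<sigma> = "\<lambda>h s. so_subst F (unif_body g e n h) (cvt ord n g a F s p)"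
  have "a \<noteq> g" using assms(1,2) by auto
  have diff: "int (length (leaves g (?\<sigma> h Plus))) - int (length (leaves g (?\<sigma> h Minus))) = peval p h"
    for h
    by (rule length_leaves_so_subst_cvt_diff[OF \<open>a \<noteq> g\<close> assms(8,5,6)])
  have "eq_theory (assoc_axioms g) (?\<sigma> h Plus) (?\<sigma> h Minus) \<longleftrightarrow> peval p h = 0" for h
  proof
    assume "eq_theory (assoc_axioms g) (?\<sigma> h Plus) (?\<sigma> h Minus)"
    then show "peval p h = 0" using diff[of h] eq_theory_assoc_length_leaves by fastforce
  next
    assume "peval p h = 0"
    then have len: "length (leaves g (?\<sigma> h Plus)) = length (leaves g (?\<sigma> h Minus))"
      using diff[of h] by simp
    \<comment> \<open>Equal leaf counts alone do not give equality in the theory; the lists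
      themselves have to agree.\<close>
    have "leaves g (?\<sigma> h Plus) = leaves g (?\<sigma> h Minus)"
    proof (cases "\<forall>i<n. h i = 0")
      case True
      show ?thesis
      proof (cases "is_const p")
        case True
        with len \<open>a \<noteq> g\<close> show ?thesis
          by (simp add: leaves_so_subst_cvt_const del: sign_part.simps)
      next
        case False
        \<comment> \<open>Both lists are copies of \<open>a\<close> followed by the leaves of
          \<open>e\<close>, so equal lengths force equally many copies.\<close>
        with len True \<open>a \<noteq> g\<close> \<open>ground e\<close> show ?thesis
          by (simp add: leaves_so_subst_cvt unif_body_def subst_ground del: sign_part.simps)
      qed
    next
      case False
      \<comment> \<open>A list whose only element is \<open>a\<close> is determined by its
        length.\<close>
      have "leaves g (?\<sigma> h s) = replicate (length (leaves g (?\<sigma> h s))) (Fn a [])" for s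
        using set_leaves_so_subst_cvt[OF \<open>a \<noteq> g\<close> False, of F e ord s p]
        by (intro replicate_length_same[symmetric]) blast
      with len show ?thesis by metis
    qed
    then show "eq_theory (assoc_axioms g) (?\<sigma> h Plus) (?\<sigma> h Minus)" by (rule eq_theory_assocI)
  qed
  then show ?thesis by (simp add: induced_asogu_def)
qed

end
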